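(* Let $\mathcal{P}$ be a Poisson algebra of dimension $n$ over an algebraically closed field. If $\mathcal{P}$ has a maximal subalgebra $A$ which is abelian, then $\dim(A)=n-1$. Moreover, if $N(A)=A$, then $\mathcal{P}_A$ is trivial, i.e. the associative commutative multiplication of $\mathcal{P}$ is identically zero.
   Context: A Poisson algebra over a field $\mathbb{F}$ is an $\mathbb{F}$-vector space $\mathcal{P}$ with two bilinear multiplications, $\cdot$ (written by concatenation) and $[\cdot,\cdot]$, such that $\mathcal{P}_A:=(\mathcal{P},\cdot)$ is an associative commutative algebra (not necessarily unital; here the subscript $A$ stands for "associative" and is unrelated to the subalgebra $A$), $\mathcal{P}_L:=(\mathcal{P},[\cdot,\cdot])$ is a Lie algebra, and $[xy,z]=[x,z]y+x[y,z]$ for all $x,y,z$. A subalgebra is a linear subspace closed under both multiplications; a maximal subalgebra is a proper subalgebra not strictly contained in any other proper subalgebra; a subalgebra $A$ is abelian if $A\cdot A+[A,A]=0$. The normalizer of a subalgebra $A$ is $N(A)=\{x\in\mathcal{P}: Ax\subseteq A \text{ and } [A,x]\subseteq A\}$. *)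

theory Defs
  imports "HOL-Computational_Algebra.Computational_Algebra"
begin

text \<open>
  The underlying vector space is a whole type with scalar multiplication \<open>scale\<close>,
  as in the library locale \<^locale>\<open>vector_space\<close>. The Lie bracket is required to be
  alternating, not merely antisymmetric, so that characteristic 2 is treated correctly.
  The associative multiplication is not assumed to have a unit.
\<close>

locale poisson_algebra = vector_space scale
  for scale :: "'k::field \<Rightarrow> 'v::ab_group_add \<Rightarrow> 'v" (infixr "*s" 75) +
  fixes mult :: "'v \<Rightarrow> 'v \<Rightarrow> 'v" (infixl "\<odot>" 70)
    and bracket :: "'v \<Rightarrow> 'v \<Rightarrow> 'v"
  assumes mult_linear_left: "Vector_Spaces.linear scale scale (\<lambda>x. x \<odot> y)"
    and mult_linear_right: "Vector_Spaces.linear scale scale (\<lambda>y. x \<odot> y)"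
    and bracket_linear_left: "Vector_Spaces.linear scale scale (\<lambda>x. bracket x y)"
    and bracket_linear_right: "Vector_Spaces.linear scale scale (\<lambda>y. bracket x y)"
    and mult_assoc: "(x \<odot> y) \<odot> z = x \<odot> (y \<odot> z)"
    and mult_comm: "x \<odot> y = y \<odot> x"
    and bracket_self: "bracket x x = 0"
    and jacobi: "bracket x (bracket y z) + bracket y (bracket z x) + bracket z (bracket x y) = 0"
    and leibniz: "bracket (x \<odot> y) z = bracket x z \<odot> y + x \<odot> bracket y z"
begin

definition subalgebra :: "'v set \<Rightarrow> bool" where
  "subalgebra A \<longleftrightarrow>
     subspace A \<and> (\<forall>x\<in>A. \<forall>y\<in>A. x \<odot> y \<in> A) \<and> (\<forall>x\<in>A. \<forall>y\<in>A. bracket x y \<in> A)"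

definition maximal_subalgebra :: "'v set \<Rightarrow> bool" where
  "maximal_subalgebra A \<longleftrightarrow>
     subalgebra A \<and> A \<noteq> UNIV \<and> \<not> (\<exists>B. subalgebra B \<and> B \<noteq> UNIV \<and> A \<subset> B)"

definition mult_space :: "'v set \<Rightarrow> 'v set \<Rightarrow> 'v set" where
  "mult_space A B = span {x \<odot> y | x y. x \<in> A \<and> y \<in> B}"

definition bracket_space :: "'v set \<Rightarrow> 'v set \<Rightarrow> 'v set" where
  "bracket_space A B = span {bracket x y | x y. x \<in> A \<and> y \<in> B}"

definition abelian_subalgebra :: "'v set \<Rightarrow> bool" where
  "abelian_subalgebra A \<longleftrightarrow>
     subalgebra A \<and> {u + v | u v. u \<in> mult_space A A \<and> v \<in> bracket_space A A} = {0}"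

definition normalizer :: "'v set \<Rightarrow> 'v set" where
  "normalizer A = {x. (\<forall>a\<in>A. a \<odot> x \<in> A) \<and> (\<forall>a\<in>A. bracket a x \<in> A)}"

end

end

theory Submission
  imports Defs
begin

text \<open>
  The normalizer \<open>N(A)\<close> is a subalgebra, so it is \<open>A\<close> or everything. Any commuting family of
  operators preserving \<open>A\<close> has a common eigenvector modulo \<open>A\<close>.

  If \<open>N(A)\<close> is everything, take \<open>w\<close> outside \<open>A\<close> to be a common eigenvector modulo \<open>A\<close> of all
  multiplications; then \<open>w\<^sup>2 \<in> A + \<langle>w\<rangle>\<close>, so \<open>A + \<langle>w\<rangle>\<close> is a subalgebra.

  If \<open>N(A) = A\<close>, take a common eigenvector \<open>w\<close> of all \<open>a\<cdot>\<close> and \<open>[a,\<cdot>]\<close> with \<open>a \<in> A\<close>. Since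
  \<open>a\<cdot>\<close> squares to zero, \<open>A w \<subseteq> A\<close>, so \<open>w \<notin> N(A)\<close> gives \<open>a \<in> A\<close> with \<open>[a,w] \<notin> A\<close>. After
  rescaling \<open>a\<close>, the vector \<open>y = [a,w]\<close> lies in \<open>w + A\<close>, hence \<open>[a,y] = y\<close>. For
  \<open>b \<in> A\<close> we get \<open>b y = [a, b y] = 0\<close>, because \<open>b y \<in> A\<close>, and then \<open>y\<^sup>2 = [a,y] y = [a y, y] = 0\<close>. Hence \<open>A + \<langle>y\<rangle>\<close> is a subalgebra, so it is everything,
  and all products vanish.
\<close>

section \<open>Polynomials in a linear operator, applied to a vector\<close>

text \<open>This is p(T) z in Horner form, so that induction on \<open>pCons\<close> computes it
  directly.\<close>

definition poly_op ::
  "('a::zero \<Rightarrow> 'b \<Rightarrow> 'b::ab_group_add) \<Rightarrow> ('b \<Rightarrow> 'b) \<Rightarrow> 'a poly \<Rightarrow> 'b \<Rightarrow> 'b" where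
  "poly_op s T p z = fold_coeffs (\<lambda>c v. s c z + T v) p 0"

context vector_space
begin

context
  fixes T :: "'b \<Rightarrow> 'b"
  assumes lin: "Vector_Spaces.linear scale scale T"
begin

interpretation T: Vector_Spaces.linear scale scale T
  by (rule lin)

lemma poly_op_0: "poly_op scale T 0 z = 0"
  by (simp add: poly_op_def)

lemma poly_op_pCons: "poly_op scale T (pCons c p) z = scale c z + T (poly_op scale T p z)"
  by (cases "c = 0 \<and> p = 0") (auto simp: poly_op_def T.zero)

lemma poly_op_add: "poly_op scale T (p + q) z = poly_op scale T p z + poly_op scale T q z"
  by (induction p q rule: poly_induct2)
    (simp_all add: poly_op_0 poly_op_pCons T.add scale_left_distrib)

lemma poly_op_smult: "poly_op scale T (smult c p) z = scale c (poly_op scale T p z)"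
  by (induction p) (simp_all add: poly_op_0 poly_op_pCons T.scale scale_right_distrib)

lemma poly_op_sum: "poly_op scale T (\<Sum>i\<in>I. f i) z = (\<Sum>i\<in>I. poly_op scale T (f i) z)"
  by (induction I rule: infinite_finite_induct) (simp_all add: poly_op_0 poly_op_add)

lemma poly_op_monom: "poly_op scale T (monom c i) z = scale c ((T ^^ i) z)"
  by (induction i) (simp_all add: monom_0 monom_Suc poly_op_0 poly_op_pCons T.zero T.scale)

lemma poly_op_diff_arg: "poly_op scale T p (x - y) = poly_op scale T p x - poly_op scale T p y"
  by (induction p) (simp_all add: poly_op_0 poly_op_pCons T.diff scale_right_diff_distrib)

lemma poly_op_scale_arg: "poly_op scale T p (scale c x) = scale c (poly_op scale T p x)"
  by (induction p) (simp_all add: poly_op_0 poly_op_pCons T.scale scale_right_distrib mult.commute)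

lemma poly_op_apply_arg: "poly_op scale T p (T x) = T (poly_op scale T p x)"
  by (induction p) (simp_all add: poly_op_0 poly_op_pCons T.zero T.add T.scale)

text \<open>Since q(T) commutes with T, the factor T - c can be moved onto the vector. Inductions on
  the degree can then replace z by T z - c z.\<close>

lemma poly_op_linear_factor:
  "poly_op scale T ([:- c, 1:] * q) z = poly_op scale T q (T z - scale c z)"
proof -
  have "[:- c, 1:] * q = smult (- c) q + pCons 0 q"
    by simp
  then show ?thesis
    by (simp only: poly_op_add poly_op_smult poly_op_pCons poly_op_diff_arg poly_op_scale_arg
        poly_op_apply_arg) simp
qed

end

end

context finite_dimensional_vector_space
begin

lemma annihilating_poly_exists:
  assumes lin: "Vector_Spaces.linear scale scale T"
  shows "\<exists>p. p \<noteq> 0 \<and> poly_op scale T p z = 0"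
\<comment> \<open>Dependence is a property of sets, so repeated iterates must be handled apart.
  Without repetition there are \<open>dimension\<close> + 1 distinct vectors, one too many to be
  independent.\<close>
proof (cases "inj_on (\<lambda>i. (T ^^ i) z) {..dimension}")
  case False
  then obtain i j where "i \<noteq> j" "(T ^^ i) z = (T ^^ j) z"
    by (auto simp: inj_on_def)
  then have "poly_op scale T (monom 1 i + smult (- 1) (monom 1 j)) z = 0"
    by (simp only: poly_op_add[OF lin] poly_op_smult[OF lin] poly_op_monom[OF lin]) simp
  moreover have "coeff (monom 1 i + smult (- 1) (monom 1 j)) i = (1 :: 'a)"
    using \<open>i \<noteq> j\<close> by simp
  then have "monom 1 i + smult (- 1) (monom 1 j) \<noteq> (0 :: 'a poly)"
    by (metis coeff_0 zero_neq_one)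
  ultimately show ?thesis by blast
next
  case True
  let ?f = "\<lambda>i. (T ^^ i) z"
  let ?S = "?f ` {..dimension}"
  have "card ?S = Suc dimension"
    using True by (simp add: card_image)
  then have "dependent ?S"
    using independent_card_le_dim[of ?S UNIV] dim_UNIV by (force simp: dimension_def)
  then obtain u v where uv: "v \<in> ?S" "u v \<noteq> 0" "(\<Sum>v\<in>?S. scale (u v) v) = 0"
    using dependent_finite[of ?S] by auto
  obtain k where k: "k \<le> dimension" "u (?f k) \<noteq> 0"
    using uv by auto
  let ?p = "\<Sum>i\<le>dimension. monom (u (?f i)) i"
  have "poly_op scale T ?p z = (\<Sum>i\<le>dimension. scale (u (?f i)) (?f i))"
    by (simp add: poly_op_sum[OF lin] poly_op_monom[OF lin])
  also have "\<dots> = (\<Sum>v\<in>?S. scale (u v) v)"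
    using sum.reindex[OF True, of "\<lambda>v. scale (u v) v"] by simp
  finally have "poly_op scale T ?p z = 0"
    using uv by simp
  moreover have "coeff ?p k = u (?f k)"
    using k by (simp add: coeff_sum)
  then have "?p \<noteq> 0"
    using k by (metis coeff_0)
  ultimately show ?thesis by blast
qed

end

section \<open>Eigenvectors modulo a subspace\<close>

text \<open>Split off a root c, p = (X - c) q, and put w = T z - c z, so that q(T) w = p(T) z. If w
  lies in A, then z is the desired vector; otherwise the induction continues with q and w. A nonzero
  constant p cannot occur, as it would put z in A.\<close>

lemma (in vector_space) eigenvector_modulo_of_poly_op:
  fixes p :: "'a poly"
  assumes lin: "Vector_Spaces.linear scale scale T"
    and alg_closed: "\<And>q :: 'a poly. degree q > 0 \<Longrightarrow> \<exists>c. poly q c = 0"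
    and S: "subspace S" "T ` S \<subseteq> S" and A: "subspace A"
    and z: "z \<in> S" "z \<notin> A" and p: "p \<noteq> 0" "poly_op scale T p z \<in> A"
  shows "\<exists>c w. w \<in> S \<and> w \<notin> A \<and> T w - scale c w \<in> A"
  using z p
proof (induction "degree p" arbitrary: p z rule: less_induct)
  case less
  show ?case
  proof (cases "degree p = 0")
    case True
    then obtain c where "p = [:c:]" "c \<noteq> 0"
      using \<open>p \<noteq> 0\<close> by (metis degree_eq_zeroE pCons_0_0)
    interpret T: Vector_Spaces.linear scale scale T
      by (rule lin)
    have "scale c z \<in> A"
      using less.prems \<open>p = [:c:]\<close> by (simp add: poly_op_pCons[OF lin] poly_op_0[OF lin] T.zero)
    then have "scale (inverse c) (scale c z) \<in> A"
      using A subspace_scale by blast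
    then show ?thesis
      using \<open>c \<noteq> 0\<close> less.prems by simp
  next
    case False
    then obtain c where "poly p c = 0"
      using alg_closed by blast
    then obtain q where q: "p = [:- c, 1:] * q"
      by (auto simp: poly_eq_0_iff_dvd)
    then have "q \<noteq> 0"
      using \<open>p \<noteq> 0\<close> by auto
    then have deg: "degree q < degree p"
      unfolding q by (subst degree_mult_eq) auto
    let ?w = "T z - scale c z"
    have "?w \<in> S"
      using S less.prems by (blast intro: subspace_diff subspace_scale)
    moreover have "poly_op scale T q ?w \<in> A"
      using less.prems(4) unfolding q poly_op_linear_factor[OF lin] .
    ultimately show ?thesis
      using less.hyps[OF deg, of ?w] \<open>q \<noteq> 0\<close> less.prems by blast
  qed
qed

text \<open>
  On an invariant subspace of minimal dimension strictly containing \<open>A\<close>, every operator of the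
  family is scalar modulo \<open>A\<close>, since its eigenspace is again invariant.
\<close>

lemma (in finite_dimensional_vector_space) common_eigenvector_modulo:
  assumes alg_closed: "\<And>q :: 'a poly. degree q > 0 \<Longrightarrow> \<exists>c. poly q c = 0"
    and lin: "\<And>f. f \<in> F \<Longrightarrow> Vector_Spaces.linear scale scale f"
    and comm: "\<And>f g x. f \<in> F \<Longrightarrow> g \<in> F \<Longrightarrow> f (g x) = g (f x)"
    and inv: "\<And>f. f \<in> F \<Longrightarrow> f ` A \<subseteq> A"
    and A: "subspace A" "A \<noteq> UNIV"
  shows "\<exists>w. w \<notin> A \<and> (\<forall>f\<in>F. \<exists>c. f w - scale c w \<in> A)"
proof -
  define P where "P S \<longleftrightarrow> subspace S \<and> A \<subset> S \<and> (\<forall>f\<in>F. f ` S \<subseteq> S)" for S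
  have "P UNIV"
    using A by (auto simp: P_def subspace_UNIV)
  then obtain S where S: "P S" and min: "\<And>S'. P S' \<Longrightarrow> dim S \<le> dim S'"
    using ex_has_least_nat[of P UNIV dim] by blast
  \<comment> \<open>\<open>w\<close> is fixed before \<open>f\<close>: each operator turns out to be
    scalar on all of \<open>S\<close> modulo \<open>A\<close>, so any such vector serves the whole
    family.\<close>
  from S obtain w where w: "w \<in> S" "w \<notin> A"
    by (auto simp: P_def)
  have "\<exists>c. f w - scale c w \<in> A" if f: "f \<in> F" for f
  proof -
    interpret f: Vector_Spaces.linear scale scale f
      using f lin by blast
    obtain p where p: "p \<noteq> 0" "poly_op scale f p w = 0"
      using annihilating_poly_exists[OF lin[OF f]] by blast
    obtain c v where v: "v \<in> S" "v \<notin> A" "f v - scale c v \<in> A"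
      using eigenvector_modulo_of_poly_op[OF lin[OF f] alg_closed, of S A w p]
        S w p f A subspace_0[OF A(1)] unfolding P_def by auto
    define E where "E = {z \<in> S. f z - scale c z \<in> A}"
    have "subspace E"
    proof (rule subspaceI)
      show "0 \<in> E"
        using S A by (auto simp: E_def P_def f.zero subspace_0)
    next
      fix x y assume "x \<in> E" "y \<in> E"
      moreover have "f (x + y) - scale c (x + y) = (f x - scale c x) + (f y - scale c y)"
        by (simp add: f.add scale_right_distrib)
      ultimately show "x + y \<in> E"
        using S A subspace_add by (auto simp: E_def P_def)
    next
      fix d x assume "x \<in> E"
      moreover have "f (scale d x) - scale c (scale d x) = scale d (f x - scale c x)"
        by (simp add: f.scale scale_right_diff_distrib mult.commute)
      ultimately show "scale d x \<in> E"
        using S A subspace_scale by (auto simp: E_def P_def)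
    qed
    moreover have "A \<subset> E"
    proof -
      have "A \<subseteq> E"
        using S inv[OF f] A by (auto simp: E_def P_def intro!: subspace_diff subspace_scale)
      moreover have "v \<in> E"
        using v by (simp add: E_def)
      ultimately show ?thesis
        using v by blast
    qed
    moreover have "g ` E \<subseteq> E" if g: "g \<in> F" for g
    proof
      interpret g: Vector_Spaces.linear scale scale g
        using g lin by blast
      fix y assume "y \<in> g ` E"
      then obtain x where x: "y = g x" "x \<in> E" by blast
      have "f y - scale c y = g (f x - scale c x)"
        using comm[OF f g] by (simp add: x g.diff g.scale)
      then show "y \<in> E"
        using x g inv[OF g] S by (auto simp: E_def P_def)
    qed
    ultimately have "P E"
      by (simp add: P_def)
    moreover have "E \<subseteq> S"
      by (auto simp: E_def)
    \<comment> \<open>\<open>E\<close> lies in \<open>S\<close> and competes with it for minimal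
      dimension, so the two agree.\<close>
    ultimately have "E = S"
      using min[of E] subspace_dim_equal[of E S] S by (auto simp: P_def)
    then show ?thesis
      using w by (auto simp: E_def)
  qed
  then show ?thesis
    using w by blast
qed

section \<open>Calculation rules, the normalizer, and one-dimensional extensions of a
  subalgebra\<close>

context poisson_algebra
begin

lemma mult_add_left: "(x + y) \<odot> z = x \<odot> z + y \<odot> z"
  by (rule module_hom.add[OF Vector_Spaces.linear.axioms(3)[OF mult_linear_left]])

lemma mult_add_right: "z \<odot> (x + y) = z \<odot> x + z \<odot> y"
  by (rule module_hom.add[OF Vector_Spaces.linear.axioms(3)[OF mult_linear_right]])

lemma mult_scale_left: "(c *s x) \<odot> z = c *s (x \<odot> z)"
  by (rule module_hom.scale[OF Vector_Spaces.linear.axioms(3)[OF mult_linear_left]])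

lemma mult_scale_right: "z \<odot> (c *s x) = c *s (z \<odot> x)"
  by (rule module_hom.scale[OF Vector_Spaces.linear.axioms(3)[OF mult_linear_right]])

lemma bracket_add_left: "bracket (x + y) z = bracket x z + bracket y z"
  by (rule module_hom.add[OF Vector_Spaces.linear.axioms(3)[OF bracket_linear_left]])

lemma bracket_add_right: "bracket z (x + y) = bracket z x + bracket z y"
  by (rule module_hom.add[OF Vector_Spaces.linear.axioms(3)[OF bracket_linear_right]])

lemma bracket_scale_left: "bracket (c *s x) z = c *s bracket x z"
  by (rule module_hom.scale[OF Vector_Spaces.linear.axioms(3)[OF bracket_linear_left]])

lemma bracket_scale_right: "bracket z (c *s x) = c *s bracket z x"
  by (rule module_hom.scale[OF Vector_Spaces.linear.axioms(3)[OF bracket_linear_right]])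

lemmas bilinear_simps =
  mult_add_left mult_add_right mult_scale_left mult_scale_right
  bracket_add_left bracket_add_right bracket_scale_left bracket_scale_right

lemma mult_zero_left: "0 \<odot> x = 0"
  using mult_scale_left[of 0 0 x] by simp

lemma mult_zero_right: "x \<odot> 0 = 0"
  using mult_scale_right[of x 0 0] by simp

lemma bracket_zero_left: "bracket 0 x = 0"
  using bracket_scale_left[of 0 0 x] by simp

lemma bracket_zero_right: "bracket x 0 = 0"
  using bracket_scale_right[of x 0 0] by simp

lemma bracket_antisym: "bracket y x = - bracket x y"
proof -
  have "bracket y x + bracket x y = 0"
    using bracket_self[of "x + y"]
    unfolding bracket_add_left bracket_add_right bracket_self[of x] bracket_self[of y]
    by (simp add: add.commute)
  then show ?thesis
    by (simp add: eq_neg_iff_add_eq_0)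
qed

text \<open>Antisymmetry transfers \<open>leibniz\<close> to the other argument. Signs are written
  as scaling by -1 so that the scaling rules carry them through products.\<close>

lemma leibniz_right: "bracket z (x \<odot> y) = bracket z x \<odot> y + x \<odot> bracket z y"
proof -
  have "bracket z (x \<odot> y) = (-1) *s bracket (x \<odot> y) z"
    using bracket_antisym[of z "x \<odot> y"] by simp
  also have "\<dots> = ((-1) *s bracket x z) \<odot> y + x \<odot> ((-1) *s bracket y z)"
    by (simp only: leibniz scale_right_distrib mult_scale_left mult_scale_right)
  also have "\<dots> = bracket z x \<odot> y + x \<odot> bracket z y"
    using bracket_antisym[of z x] bracket_antisym[of z y] by simp
  finally show ?thesis .
qed

text \<open>The Jacobi identity in derivation form, from which brackets with elements of an abelian
  subalgebra are seen to commute.\<close>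

lemma bracket_bracket: "bracket a (bracket x y) = bracket (bracket a x) y + bracket x (bracket a y)"
proof -
  have *: "bracket a (bracket x y) = - (bracket x (bracket y a) + bracket y (bracket a x))"
    using jacobi[of a x y] unfolding eq_neg_iff_add_eq_0 by (simp add: add.assoc)
  have "bracket x (bracket a y) = - bracket x (bracket y a)"
    using bracket_antisym[of a y] bracket_scale_right[of x "-1" "bracket y a"] by simp
  moreover have "bracket (bracket a x) y = - bracket y (bracket a x)"
    by (rule bracket_antisym)
  ultimately show ?thesis
    using * by simp
qed

text \<open>Associativity and the two derivation rules move a onto one factor at a time. The least
  direct case is a [x,y] = [a x, y] - [a,y] x, which is Leibniz solved for its last term.\<close>

lemma subalgebra_normalizer:
  assumes "subalgebra A"
  shows "subalgebra (normalizer A)"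
proof -
  have A: "subspace A"
    using assms by (simp add: subalgebra_def)
  note A' = subspace_0[OF A] subspace_add[OF A] subspace_diff[OF A] subspace_scale[OF A]
  have "subspace (normalizer A)"
    by (rule subspaceI)
      (auto simp: normalizer_def mult_zero_right bracket_zero_right bilinear_simps A')
  moreover have "x \<odot> y \<in> normalizer A" if "x \<in> normalizer A" "y \<in> normalizer A" for x y
  proof -
    have "a \<odot> (x \<odot> y) \<in> A" if "a \<in> A" for a
      using \<open>x \<in> _\<close> \<open>y \<in> _\<close> that by (simp add: normalizer_def flip: mult_assoc)
    moreover have "bracket a (x \<odot> y) \<in> A" if "a \<in> A" for a
      using \<open>x \<in> _\<close> \<open>y \<in> _\<close> that
      by (simp add: normalizer_def leibniz_right[of a x y] mult_comm[of x "bracket a y"] A')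
    ultimately show ?thesis
      by (simp add: normalizer_def)
  qed
  moreover have "bracket x y \<in> normalizer A" if x: "x \<in> normalizer A" and y: "y \<in> normalizer A"
    for x y
  proof -
    have "a \<odot> bracket x y \<in> A" if "a \<in> A" for a
    proof -
      have "a \<odot> bracket x y = bracket (a \<odot> x) y - bracket a y \<odot> x"
        by (simp add: leibniz)
      also have "\<dots> \<in> A"
        using x y that by (simp add: normalizer_def A')
      finally show ?thesis .
    qed
    moreover have "bracket a (bracket x y) \<in> A" if "a \<in> A" for a
    proof -
      have "bracket x (bracket a y) = (-1) *s bracket (bracket a y) x"
        using bracket_antisym[of x "bracket a y"] by simp
      moreover have "bracket (bracket a y) x \<in> A" "bracket (bracket a x) y \<in> A"
        using x y that by (simp_all add: normalizer_def)
      ultimately show ?thesis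
        unfolding bracket_bracket[of a x y] by (simp only: A')
    qed
    ultimately show ?thesis
      by (simp add: normalizer_def)
  qed
  ultimately show ?thesis
    by (simp add: subalgebra_def)
qed

lemma abelian_mult:
  assumes "abelian_subalgebra A" "x \<in> A" "y \<in> A"
  shows "x \<odot> y = 0"
proof -
  have "x \<odot> y \<in> mult_space A A"
    unfolding mult_space_def using assms by (auto intro: span_base)
  moreover have "0 \<in> bracket_space A A"
    unfolding bracket_space_def by (rule span_zero)
  ultimately have "x \<odot> y + 0 \<in> {0}"
    using assms(1) unfolding abelian_subalgebra_def by blast
  then show ?thesis by simp
qed

lemma abelian_bracket:
  assumes "abelian_subalgebra A" "x \<in> A" "y \<in> A"
  shows "bracket x y = 0"
proof -
  have "bracket x y \<in> bracket_space A A"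
    unfolding bracket_space_def using assms by (auto intro: span_base)
  moreover have "0 \<in> mult_space A A"
    unfolding mult_space_def by (rule span_zero)
  ultimately have "0 + bracket x y \<in> {0}"
    using assms(1) unfolding abelian_subalgebra_def by blast
  then show ?thesis by simp
qed

lemma span_insert_subspaceE:
  assumes "subspace A" "x \<in> span (insert w A)"
  obtains a c where "a \<in> A" "x = a + c *s w"
proof -
  from assms obtain c where "x - c *s w \<in> A"
    by (auto simp: span_breakdown_eq span_eq_iff[THEN iffD2])
  then show ?thesis
    by (intro that[of "x - c *s w" c]) auto
qed

text \<open>By bilinearity, commutativity and antisymmetry, closure of A + <w> only needs the
  products a w, w w and the brackets [a,w], because [w,w] = 0. Maximality then forces this strictly
  larger subalgebra to be everything.\<close>

lemma maximal_span_insert: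
  assumes max: "maximal_subalgebra A" and "w \<notin> A"
    and mult: "\<And>a. a \<in> A \<Longrightarrow> a \<odot> w \<in> span (insert w A)" "w \<odot> w \<in> span (insert w A)"
    and bracket: "\<And>a. a \<in> A \<Longrightarrow> bracket a w \<in> span (insert w A)"
  shows "span (insert w A) = UNIV"
proof -
  let ?B = "span (insert w A)"
  have sub: "subalgebra A"
    using max by (simp add: maximal_subalgebra_def)
  then have A: "subspace A"
    by (simp add: subalgebra_def)
  have AB: "a \<in> ?B" if "a \<in> A" for a
    using that by (auto intro: span_base)
  have "bracket w a \<in> ?B" if "a \<in> A" for a
    using bracket[OF that] bracket_antisym[of w a] span_neg by metis
  then have "x \<odot> y \<in> ?B \<and> bracket x y \<in> ?B" if xy: "x \<in> ?B" "y \<in> ?B" for x y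
  proof -
    obtain a c where x: "a \<in> A" "x = a + c *s w"
      using span_insert_subspaceE[OF A xy(1)] .
    obtain b d where y: "b \<in> A" "y = b + d *s w"
      using span_insert_subspaceE[OF A xy(2)] .
    have "a \<odot> b \<in> ?B" "bracket a b \<in> ?B"
      using sub x y by (auto simp: subalgebra_def intro: AB)
    then show ?thesis
      using x y mult bracket \<open>\<And>a. a \<in> A \<Longrightarrow> bracket w a \<in> ?B\<close>
      by (auto simp: bilinear_simps bracket_self mult_comm[of w b]
          intro!: span_add span_scale span_zero)
  qed
  then have "subalgebra ?B"
    by (simp add: subalgebra_def)
  moreover have "A \<subset> ?B"
    using AB \<open>w \<notin> A\<close> span_base[of w "insert w A"] by blast
  ultimately show ?thesis
    using max by (auto simp: maximal_subalgebra_def)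
qed

end

section \<open>Codimension one and the two cases for the normalizer\<close>

lemma (in finite_dimensional_vector_space) dim_hyperplane:
  assumes "subspace A" "w \<notin> A" "span (insert w A) = UNIV"
  shows "dim UNIV = Suc (dim A)"
proof -
  have "dim UNIV = dim (insert w A)"
    using assms(3) by (metis dim_span)
  also have "\<dots> = Suc (dim A)"
    using assms(1,2) by (simp add: dim_insert span_eq_iff[THEN iffD2])
  finally show ?thesis .
qed

lemma (in poisson_algebra) maximal_abelian_normalizer_UNIV:
  assumes fin: "finite_dimensional_vector_space scale Basis"
    and alg_closed: "\<And>q :: 'k poly. degree q > 0 \<Longrightarrow> \<exists>c. poly q c = 0"
    and max: "maximal_subalgebra A" and norm: "normalizer A = UNIV"
  shows "\<exists>w. w \<notin> A \<and> span (insert w A) = UNIV"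
proof -
  interpret finite_dimensional_vector_space scale Basis
    by (rule fin)
  have A: "subspace A" "A \<noteq> UNIV"
    using max by (auto simp: maximal_subalgebra_def subalgebra_def)
  have mult: "a \<odot> x \<in> A" and bracket: "bracket a x \<in> A" if "a \<in> A" for a x
    using norm that by (auto simp: normalizer_def)
  have mult': "x \<odot> a \<in> A" if "a \<in> A" for a x
    using mult[OF that] mult_comm by metis
  have "\<exists>w. w \<notin> A \<and> (\<forall>f\<in>range (\<odot>). \<exists>c. f w - c *s w \<in> A)"
  proof (rule common_eigenvector_modulo[OF alg_closed _ _ _ A])
    fix f g x assume "f \<in> range (\<odot>)" "g \<in> range (\<odot>)"
    then show "f (g x) = g (f x)"
      by (auto simp flip: mult_assoc) (metis mult_comm)
  qed (auto simp: mult_linear_right mult')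
  \<comment> \<open>The family contains multiplication by \<open>w\<close> itself, which yields
    control of the square of \<open>w\<close>.\<close>
  then obtain w c where w: "w \<notin> A" "w \<odot> w - c *s w \<in> A"
    by blast
  have AB: "a \<in> span (insert w A)" if "a \<in> A" for a
    using that by (auto intro: span_base)
  have "w \<odot> w \<in> span (insert w A)"
    using w A by (auto simp: span_breakdown_eq span_eq_iff[THEN iffD2])
  then have "span (insert w A) = UNIV"
    using w mult bracket AB by (intro maximal_span_insert[OF max]) auto
  then show ?thesis
    using w by blast
qed

lemma (in poisson_algebra) maximal_abelian_self_normalizing:
  assumes fin: "finite_dimensional_vector_space scale Basis"
    and alg_closed: "\<And>q :: 'k poly. degree q > 0 \<Longrightarrow> \<exists>c. poly q c = 0"
    and max: "maximal_subalgebra A" and ab: "abelian_subalgebra A" and norm: "normalizer A = A"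
  shows "(\<exists>w. w \<notin> A \<and> span (insert w A) = UNIV) \<and> (\<forall>x y. x \<odot> y = 0)"
proof -
  interpret finite_dimensional_vector_space scale Basis
    by (rule fin)
  have A: "subspace A" "A \<noteq> UNIV"
    using max by (auto simp: maximal_subalgebra_def subalgebra_def)
  note A' = subspace_0[OF A(1)] subspace_add[OF A(1)] subspace_diff[OF A(1)] subspace_scale[OF A(1)]
  note ab' = abelian_mult[OF ab] abelian_bracket[OF ab]
  let ?F = "(\<odot>) ` A \<union> bracket ` A"
  have comm_mult: "a \<odot> (b \<odot> x) = b \<odot> (a \<odot> x)" for a b x
    by (metis mult_assoc mult_comm)
  \<comment> \<open>The derivation rules leave error terms [a,b] x and [[a,b],x], which vanish as
    \<open>A\<close> is abelian.\<close>
  have comm_bracket: "bracket a (bracket b x) = bracket b (bracket a x)"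
    and comm_mixed: "bracket a (b \<odot> x) = b \<odot> bracket a x" if "a \<in> A" "b \<in> A" for a b x
    using that by (simp_all add: bracket_bracket[of a] leibniz_right ab' bracket_zero_left mult_zero_left)
  have "\<exists>w. w \<notin> A \<and> (\<forall>f\<in>?F. \<exists>c. f w - c *s w \<in> A)"
    by (rule common_eigenvector_modulo[OF alg_closed _ _ _ A])
      (auto simp: mult_linear_right bracket_linear_right comm_bracket comm_mixed ab' A'
        intro: comm_mult)
  then obtain w where w: "w \<notin> A" "\<And>f. f \<in> ?F \<Longrightarrow> \<exists>c. f w - c *s w \<in> A"
    by blast
  have Aw: "a \<odot> w \<in> A" if a: "a \<in> A" for a
  proof -
    obtain c where c: "a \<odot> w - c *s w \<in> A"
      using w(2) a by blast
    have "a \<odot> (a \<odot> w - c *s w) = 0"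
      using ab' a c by blast
    moreover have "a \<odot> w = (a \<odot> w - c *s w) + c *s w"
      by simp
    moreover have "a \<odot> (a \<odot> w) = 0"
      by (simp add: ab' a mult_zero_left flip: mult_assoc)
    \<comment> \<open>Applying \<open>a\<close> to its own eigenvector relation: either c = 0 and
      the relation puts the product in \<open>A\<close>, or the product is zero.\<close>
    ultimately have "c *s (a \<odot> w) = 0"
      by (metis add_0 mult_add_right mult_scale_right)
    then show ?thesis
      using c A' by auto
  qed
  have "w \<notin> normalizer A"
    using w norm by blast
  then obtain a' where a': "a' \<in> A" "bracket a' w \<notin> A"
    using Aw by (auto simp: normalizer_def)
  obtain c where c: "bracket a' w - c *s w \<in> A"
    using w(2) a' by blast
  have "c \<noteq> 0"
    using c a' by auto
  \<comment> \<open>Rescaling makes the eigenvalue 1. As \<open>bracket a\<close> kills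
    \<open>A\<close>, replacing \<open>w\<close> by its image then gives an exact eigenvector, not
    just one modulo \<open>A\<close>.\<close>
  define a where "a = inverse c *s a'"
  define y where "y = bracket a w"
  have a: "a \<in> A"
    using a' A' by (simp add: a_def)
  have "y - w = inverse c *s (bracket a' w - c *s w)"
    using \<open>c \<noteq> 0\<close> by (simp add: y_def a_def bracket_scale_left scale_right_diff_distrib)
  then have "y - w \<in> A"
    using A'(4)[OF c] by simp
  then obtain b0 where b0: "b0 \<in> A" "y = w + b0"
    by (metis add.commute diff_add_cancel)
  have "bracket a y = bracket a w"
    using ab'(2)[OF a b0(1)] by (simp add: b0(2) bracket_add_right)
  then have ay: "bracket a y = y"
    by (simp add: y_def)
  have y: "y \<notin> A"
    using A'(3)[of y b0] b0 w by auto
  have by0: "b \<odot> y = 0" if b: "b \<in> A" for b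
  proof -
    have "b \<odot> y = b \<odot> w"
      using ab'(1)[OF b b0(1)] by (simp add: b0(2) mult_add_right)
    \<comment> \<open>The product lies in \<open>A\<close>, hence is killed by
      \<open>bracket a\<close>; yet commuting with multiplication by \<open>b\<close>,
      \<open>bracket a\<close> also fixes it.\<close>
    then have "bracket a (b \<odot> y) = 0"
      using ab'(2)[OF a Aw[OF b]] by simp
    then show ?thesis
      using comm_mixed[OF a b, of y] ay by simp
  qed
  \<comment> \<open>Leibniz for [a y, y] leaves [a,y] y, the square of \<open>y\<close>, while a y =
    0.\<close>
  have yy: "y \<odot> y = 0"
    using leibniz[of a y y] by (simp add: by0 a ay bracket_self bracket_zero_left mult_zero_right)
  have span: "span (insert y A) = UNIV"
  proof (rule maximal_span_insert[OF max y])
    fix b assume b: "b \<in> A"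
    obtain d where d: "bracket b w - d *s w \<in> A"
      using w(2) b by blast
    \<comment> \<open>The eigenvector relation modulo \<open>A\<close> passes from \<open>w\<close>
      to \<open>y\<close>, as they differ by \<open>b0\<close> in \<open>A\<close>.\<close>
    have "bracket b y - d *s y = (bracket b w - d *s w) - d *s b0"
      using ab'(2)[OF b b0(1)] by (simp add: b0(2) bracket_add_right scale_right_distrib)
    then have "bracket b y - d *s y \<in> A"
      using A'(3)[OF d A'(4)[OF b0(1)]] by simp
    then show "bracket b y \<in> span (insert y A)"
      using A by (auto simp: span_breakdown_eq span_eq_iff[THEN iffD2])
  qed (simp_all add: by0 yy span_zero)
  have "u \<odot> v = 0" for u v
  proof -
    obtain b d where u: "b \<in> A" "u = b + d *s y"
      using span_insert_subspaceE[OF A(1), of u y] span by blast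
    obtain b' d' where v: "b' \<in> A" "v = b' + d' *s y"
      using span_insert_subspaceE[OF A(1), of v y] span by blast
    show ?thesis
      using u v by (simp add: bilinear_simps mult_comm[of y b'] by0 yy ab')
  qed
  then show ?thesis
    using y span by blast
qed

theorem theorem3p1:
  fixes scale :: "'k::alg_closed_field \<Rightarrow> 'v::ab_group_add \<Rightarrow> 'v"
    and mult bracket :: "'v \<Rightarrow> 'v \<Rightarrow> 'v"
    and A :: "'v set" and n :: nat
  assumes "poisson_algebra scale mult bracket"
    and "\<exists>Basis. finite_dimensional_vector_space scale Basis"
    and "vector_space.dim scale UNIV = n"
    and "poisson_algebra.maximal_subalgebra scale mult bracket A"
    and "poisson_algebra.abelian_subalgebra scale mult bracket A"
  shows "int (vector_space.dim scale A) = int n - 1 \<and>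
         (poisson_algebra.normalizer mult bracket A = A \<longrightarrow> (\<forall>x y. mult x y = 0))"
proof -
  interpret poisson_algebra scale mult bracket
    by (rule assms)
  obtain Basis where fin: "finite_dimensional_vector_space scale Basis"
    using assms by blast
  interpret finite_dimensional_vector_space scale Basis
    by (rule fin)
  have alg_closed: "\<exists>c. poly q c = 0" if "degree q > 0" for q :: "'k poly"
    using alg_closed_imp_poly_has_root[OF that] .
  have sub: "subalgebra A"
    using assms(4) by (simp add: maximal_subalgebra_def)
  have "A \<subseteq> normalizer A"
    using sub by (auto simp: normalizer_def subalgebra_def)
  then consider "normalizer A = A" | "normalizer A = UNIV"
    using subalgebra_normalizer[OF sub] assms(4) unfolding maximal_subalgebra_def by blast
  then have "\<exists>w. w \<notin> A \<and> span (insert w A) = UNIV"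
  proof cases
    case 1
    then show ?thesis
      using maximal_abelian_self_normalizing[OF fin alg_closed assms(4,5)] by blast
  next
    case 2
    then show ?thesis
      using maximal_abelian_normalizer_UNIV[OF fin alg_closed assms(4)] by blast
  qed
  then have "dim UNIV = Suc (dim A)"
    using dim_hyperplane sub by (auto simp: subalgebra_def)
  then show ?thesis
    using maximal_abelian_self_normalizing[OF fin alg_closed assms(4,5)] assms(3) by auto
qed

end
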